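(* Let $H$ and $K$ be groups and let $G = H \Join K$ be the Zappa-Szep product of $H$ and $K$ with respect to a pair $(\alpha,\beta)$. Assume that $H$ and $K$ are left-orderable, and let $P_H \subseteq H$ and $P_K \subseteq K$ be the positive cones of (total) left orders on $H$ and $K$ respectively. Assume that \[\alpha_{k}(P_H) \subseteq P_H \quad \text{for all } k \in K.\] Then there exists a total left order $\prec$ on $G$, with positive cone $P$, such that (the embedded copy in $G$ of) $K$ is a convex subgroup of $G$ with respect to $\prec$ and $P_K = P \cap K$.
   Context: Zappa-Szep product. Let $H$, $K$ be groups and let $\operatorname{Sym}(X)$ denote the group of bijections of a set $X$. Let $\alpha: K \to \operatorname{Sym}(H)$, $k \mapsto \alpha_k$, be a group homomorphism, and let $\beta: H \to \operatorname{Sym}(K)$, $h \mapsto \beta_h$, be an anti-homomorphism, i.e. $\beta_{h_1h_2} = \beta_{h_2}\circ\beta_{h_1}$ and $\beta_1 = \mathrm{Id}_K$. Assume that for all $h,h_1,h_2\in H$ and $k,k_1,k_2\in K$, \[\alpha_{k}(h_1h_2)=\alpha_{k}(h_1)\,\alpha_{\beta_{h_1}(k)}(h_2), \qquad \beta_{h}(k_1k_2)=\beta_{\alpha_{k_2}(h)}(k_1)\,\beta_{h}(k_2).\] The Zappa-Szep product $H \Join K$ of $H$ and $K$ with respect to $(\alpha,\beta)$ is the set $H\times K$ with the product \[(h_1,k_1)(h_2,k_2) = (h_1\,\alpha_{k_1}(h_2),\ \beta_{h_2}(k_1)\,k_2).\] It is a group with identity $(1,1)$ and inverse $(h,k)^{-1}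 = (\alpha_{k^{-1}}(h^{-1}),\,\beta_{h^{-1}}(k^{-1}))$. The groups $H$ and $K$ are identified with the subgroups $H\times\{1\}$ and $\{1\}\times K$ of $H\Join K$. Orders. A (total) left order on a group $G$ is a strict total order $\prec$ on $G$ such that $g \prec h$ implies $fg \prec fh$ for all $f,g,h\in G$; $G$ is left-orderable if it admits one. The positive cone of $\prec$ is $P=\{g \in G : 1 \prec g\}$. A subset $P\subseteq G$ is the positive cone of a (unique) total left order if and only if $P\cdot P\subseteq P$, $G = P\cup P^{-1}\cup\{1\}$ and $P\cap P^{-1}=\emptyset$; the order is then given by $g\prec h \iff g^{-1}h\in P$. A subgroup $N$ of $G$ is convex with respect to $\prec$ if whenever $x,z\in N$, $y \in G$ and $x\prec y\prec z$, then $y\in N$. *)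

theory Defs
  imports "HOL-Algebra.Bij" "HOL-Algebra.Coset"
begin

section \<open>Zappa-Szep products\<close>

text \<open>\<open>BijGroup S\<close> has as carrier the bijections of \<open>S\<close> that are extensional, i.e. equal to
  \<open>undefined\<close> outside \<open>S\<close>; this is the group \<open>Sym(S)\<close>. Its product is composition, the right
  factor being applied first.\<close>

locale zappa_szep_pair = H: group H + K: group K
  for H :: "('a, 'm) monoid_scheme" (structure)
    and K :: "('b, 'n) monoid_scheme" (structure) +
  fixes \<alpha> :: "'b \<Rightarrow> 'a \<Rightarrow> 'a"
    and \<beta> :: "'a \<Rightarrow> 'b \<Rightarrow> 'b"
  assumes alpha_hom: "\<alpha> \<in> hom K (BijGroup (carrier H))"
    and beta_closed: "\<beta> \<in> carrier H \<rightarrow> carrier (BijGroup (carrier K))"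
    and beta_anti_hom: "\<lbrakk>h1 \<in> carrier H; h2 \<in> carrier H\<rbrakk> \<Longrightarrow>
      \<beta> (h1 \<otimes>\<^bsub>H\<^esub> h2) = \<beta> h2 \<otimes>\<^bsub>BijGroup (carrier K)\<^esub> \<beta> h1"
    and beta_one: "\<beta> \<one>\<^bsub>H\<^esub> = \<one>\<^bsub>BijGroup (carrier K)\<^esub>"
    and alpha_mult: "\<lbrakk>k \<in> carrier K; h1 \<in> carrier H; h2 \<in> carrier H\<rbrakk> \<Longrightarrow>
      \<alpha> k (h1 \<otimes>\<^bsub>H\<^esub> h2) = \<alpha> k h1 \<otimes>\<^bsub>H\<^esub> \<alpha> (\<beta> h1 k) h2"
    and beta_mult: "\<lbrakk>h \<in> carrier H; k1 \<in> carrier K; k2 \<in> carrier K\<rbrakk> \<Longrightarrow>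
      \<beta> h (k1 \<otimes>\<^bsub>K\<^esub> k2) = \<beta> (\<alpha> k2 h) k1 \<otimes>\<^bsub>K\<^esub> \<beta> h k2"

definition zappa_szep ::
  "('a, 'm) monoid_scheme \<Rightarrow> ('b, 'n) monoid_scheme \<Rightarrow> ('b \<Rightarrow> 'a \<Rightarrow> 'a) \<Rightarrow> ('a \<Rightarrow> 'b \<Rightarrow> 'b)
    \<Rightarrow> ('a \<times> 'b) monoid"
  where "zappa_szep H K \<alpha> \<beta> =
    \<lparr>carrier = carrier H \<times> carrier K,
     mult = (\<lambda>(h1, k1) (h2, k2). (h1 \<otimes>\<^bsub>H\<^esub> \<alpha> k1 h2, \<beta> h2 k1 \<otimes>\<^bsub>K\<^esub> k2)),
     one = (\<one>\<^bsub>H\<^esub>, \<one>\<^bsub>K\<^esub>)\<rparr>"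

context zappa_szep_pair
begin

lemma alpha_Bij: "k \<in> carrier K \<Longrightarrow> \<alpha> k \<in> Bij (carrier H)"
  using alpha_hom by (auto simp: hom_def BijGroup_def)

lemma beta_Bij: "h \<in> carrier H \<Longrightarrow> \<beta> h \<in> Bij (carrier K)"
  using beta_closed by (auto simp: BijGroup_def)

lemma alpha_in [simp, intro]: "\<lbrakk>k \<in> carrier K; h \<in> carrier H\<rbrakk> \<Longrightarrow> \<alpha> k h \<in> carrier H"
  using alpha_Bij Bij_imp_funcset by blast

lemma beta_in [simp, intro]: "\<lbrakk>h \<in> carrier H; k \<in> carrier K\<rbrakk> \<Longrightarrow> \<beta> h k \<in> carrier K"
  using beta_Bij Bij_imp_funcset by blast

lemma alpha_comp: "\<lbrakk>k1 \<in> carrier K; k2 \<in> carrier K; h \<in> carrier H\<rbrakk> \<Longrightarrow>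
    \<alpha> (k1 \<otimes>\<^bsub>K\<^esub> k2) h = \<alpha> k1 (\<alpha> k2 h)"
  using alpha_hom alpha_Bij by (simp add: hom_def BijGroup_def compose_eq)

lemma beta_comp: "\<lbrakk>h1 \<in> carrier H; h2 \<in> carrier H; k \<in> carrier K\<rbrakk> \<Longrightarrow>
    \<beta> (h1 \<otimes>\<^bsub>H\<^esub> h2) k = \<beta> h2 (\<beta> h1 k)"
  using beta_anti_hom beta_Bij by (simp add: BijGroup_def compose_eq)

lemma alpha_one_left: "h \<in> carrier H \<Longrightarrow> \<alpha> \<one>\<^bsub>K\<^esub> h = h"
  using hom_one[OF alpha_hom K.is_group group_BijGroup] by (simp add: BijGroup_def)

lemma beta_one_left: "k \<in> carrier K \<Longrightarrow> \<beta> \<one>\<^bsub>H\<^esub> k = k"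
  using beta_one by (simp add: BijGroup_def)

lemma alpha_one_right:
  assumes "k \<in> carrier K" shows "\<alpha> k \<one>\<^bsub>H\<^esub> = \<one>\<^bsub>H\<^esub>"
proof -
  have "\<alpha> k \<one>\<^bsub>H\<^esub> \<otimes>\<^bsub>H\<^esub> \<alpha> k \<one>\<^bsub>H\<^esub> = \<alpha> k \<one>\<^bsub>H\<^esub>"
    using alpha_mult[of k "\<one>\<^bsub>H\<^esub>" "\<one>\<^bsub>H\<^esub>"] assms by (simp add: beta_one_left)
  then show ?thesis using assms by (metis H.one_closed H.r_cancel_one alpha_in)
qed

lemma beta_one_right:
  assumes "h \<in> carrier H" shows "\<beta> h \<one>\<^bsub>K\<^esub> = \<one>\<^bsub>K\<^esub>"
proof -
  have "\<beta> h \<one>\<^bsub>K\<^esub> \<otimes>\<^bsub>K\<^esub> \<beta> h \<one>\<^bsub>K\<^esub> = \<beta> h \<one>\<^bsub>K\<^esub>"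
    using beta_mult[of h "\<one>\<^bsub>K\<^esub>" "\<one>\<^bsub>K\<^esub>"] assms by (simp add: alpha_one_left)
  then show ?thesis using assms by (metis K.one_closed K.r_cancel_one beta_in)
qed

lemma group_zappa_szep: "group (zappa_szep H K \<alpha> \<beta>)"
proof (rule groupI)
  fix x y z
  assume "x \<in> carrier (zappa_szep H K \<alpha> \<beta>)" "y \<in> carrier (zappa_szep H K \<alpha> \<beta>)"
    "z \<in> carrier (zappa_szep H K \<alpha> \<beta>)"
  then show "x \<otimes>\<^bsub>zappa_szep H K \<alpha> \<beta>\<^esub> y \<otimes>\<^bsub>zappa_szep H K \<alpha> \<beta>\<^esub> z
      = x \<otimes>\<^bsub>zappa_szep H K \<alpha> \<beta>\<^esub> (y \<otimes>\<^bsub>zappa_szep H K \<alpha> \<beta>\<^esub> z)"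
    by (auto simp: zappa_szep_def alpha_mult beta_mult alpha_comp beta_comp H.m_assoc K.m_assoc)
next
  fix x assume "x \<in> carrier (zappa_szep H K \<alpha> \<beta>)"
  then obtain h k where x: "x = (h, k)" and hk: "h \<in> carrier H" "k \<in> carrier K"
    by (auto simp: zappa_szep_def)
  have "\<alpha> (inv\<^bsub>K\<^esub> k) (inv\<^bsub>H\<^esub> h) \<otimes>\<^bsub>H\<^esub> \<alpha> (\<beta> (inv\<^bsub>H\<^esub> h) (inv\<^bsub>K\<^esub> k)) h = \<one>\<^bsub>H\<^esub>"
    using alpha_mult[of "inv\<^bsub>K\<^esub> k" "inv\<^bsub>H\<^esub> h" h] hk by (simp add: alpha_one_right)
  moreover have "\<beta> h (\<beta> (inv\<^bsub>H\<^esub> h) (inv\<^bsub>K\<^esub> k)) \<otimes>\<^bsub>K\<^esub> k = \<one>\<^bsub>K\<^esub>"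
    using beta_comp[of "inv\<^bsub>H\<^esub> h" h "inv\<^bsub>K\<^esub> k"] hk by (simp add: beta_one_left)
  ultimately show "\<exists>y\<in>carrier (zappa_szep H K \<alpha> \<beta>).
      y \<otimes>\<^bsub>zappa_szep H K \<alpha> \<beta>\<^esub> x = \<one>\<^bsub>zappa_szep H K \<alpha> \<beta>\<^esub>"
    using hk unfolding x
    by (intro bexI[of _ "(\<alpha> (inv\<^bsub>K\<^esub> k) (inv\<^bsub>H\<^esub> h), \<beta> (inv\<^bsub>H\<^esub> h) (inv\<^bsub>K\<^esub> k))"])
      (simp_all add: zappa_szep_def)
qed (auto simp: zappa_szep_def alpha_one_left beta_one_left beta_one_right)

lemma hom_embed_left: "(\<lambda>h. (h, \<one>\<^bsub>K\<^esub>)) \<in> hom H (zappa_szep H K \<alpha> \<beta>)"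
  by (auto simp: hom_def zappa_szep_def alpha_one_left beta_one_right)

lemma hom_embed_right: "(\<lambda>k. (\<one>\<^bsub>H\<^esub>, k)) \<in> hom K (zappa_szep H K \<alpha> \<beta>)"
  by (auto simp: hom_def zappa_szep_def alpha_one_right beta_one_left)

end


section \<open>Left orders\<close>

definition left_order :: "('a, 'm) monoid_scheme \<Rightarrow> 'a rel \<Rightarrow> bool"
  where "left_order G r \<longleftrightarrow>
    r \<subseteq> carrier G \<times> carrier G \<and> strict_linear_order_on (carrier G) r \<and>
    (\<forall>f \<in> carrier G. \<forall>g \<in> carrier G. \<forall>h \<in> carrier G.
      (g, h) \<in> r \<longrightarrow> (f \<otimes>\<^bsub>G\<^esub> g, f \<otimes>\<^bsub>G\<^esub> h) \<in> r)"

definition positive_cone :: "('a, 'm) monoid_scheme \<Rightarrow> 'a rel \<Rightarrow> 'a set"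
  where "positive_cone G r = {g \<in> carrier G. (\<one>\<^bsub>G\<^esub>, g) \<in> r}"

definition convex_subgroup :: "('a, 'm) monoid_scheme \<Rightarrow> 'a rel \<Rightarrow> 'a set \<Rightarrow> bool"
  where "convex_subgroup G r N \<longleftrightarrow>
    subgroup N G \<and>
    (\<forall>x \<in> N. \<forall>z \<in> N. \<forall>y \<in> carrier G. (x, y) \<in> r \<and> (y, z) \<in> r \<longrightarrow> y \<in> N)"

end

theory Submission
  imports Defs
begin

text \<open>The lexicographic order with \<open>H\<close> as leading factor works. Left multiplication by \<open>(f, g)\<close> acts
  on the leading coordinates by \<open>\<alpha> g\<close> followed by left translation by \<open>f\<close>, and \<open>\<alpha> g\<close> is monotone since
  \<open>\<alpha>\<^bsub>g\<^esub>(h') = \<alpha>\<^bsub>g\<^esub>(h) \<alpha>\<^bsub>g'\<^esub>(h\<inverse>h')\<close> for \<open>g' = \<beta>\<^bsub>h\<^esub>(g)\<close>; if the leading coordinates agree,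
  the second coordinates are multiplied on the left by the same element.\<close>

lemma left_order_mult:
  "\<lbrakk>left_order G r; (g, h) \<in> r; f \<in> carrier G\<rbrakk> \<Longrightarrow> (f \<otimes>\<^bsub>G\<^esub> g, f \<otimes>\<^bsub>G\<^esub> h) \<in> r"
  unfolding left_order_def by blast

text \<open>Translate by \<open>inv g\<close> in one direction and by \<open>g\<close> in the other.
  This turns comparisons into membership in the cone, the only form in which the hypothesis on
  \<alpha> can be applied.\<close>

lemma (in group) left_order_iff_positive_cone:
  assumes "left_order G r" "g \<in> carrier G" "h \<in> carrier G"
  shows "(g, h) \<in> r \<longleftrightarrow> inv g \<otimes> h \<in> positive_cone G r"
proof
  assume "(g, h) \<in> r"
  then show "inv g \<otimes> h \<in> positive_cone G r"
    using left_order_mult[OF assms(1), of g h "inv g"] assms(2,3) by (simp add: positive_cone_def)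
next
  assume "inv g \<otimes> h \<in> positive_cone G r"
  then show "(g, h) \<in> r"
    using left_order_mult[OF assms(1), of \<one> "inv g \<otimes> h" g] assms(2,3)
    by (simp add: positive_cone_def m_assoc[symmetric])
qed

context zappa_szep_pair
begin

lemma alpha_mono:
  assumes rH: "left_order H rH"
    and pos: "\<And>k. k \<in> carrier K \<Longrightarrow> \<alpha> k ` positive_cone H rH \<subseteq> positive_cone H rH"
    and k: "k \<in> carrier K" and less: "(h, h') \<in> rH"
  shows "(\<alpha> k h, \<alpha> k h') \<in> rH"
proof -
  have h: "h \<in> carrier H" "h' \<in> carrier H"
    using rH less by (auto simp: left_order_def)
  have "\<alpha> k h' = \<alpha> k h \<otimes>\<^bsub>H\<^esub> \<alpha> (\<beta> h k) (inv\<^bsub>H\<^esub> h \<otimes>\<^bsub>H\<^esub> h')"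
    using alpha_mult[of k h "inv\<^bsub>H\<^esub> h \<otimes>\<^bsub>H\<^esub> h'"] h k by (simp add: H.m_assoc[symmetric])
  then have "inv\<^bsub>H\<^esub> (\<alpha> k h) \<otimes>\<^bsub>H\<^esub> \<alpha> k h' = \<alpha> (\<beta> h k) (inv\<^bsub>H\<^esub> h \<otimes>\<^bsub>H\<^esub> h')"
    using h k by (simp add: H.m_assoc[symmetric])
  \<comment> \<open>Positivity is invoked at the twisted element \<open>\<beta> h k\<close> rather
    than at \<open>k\<close>, so invariance of the cone under \<alpha> is used at an element of
    \<open>K\<close> that varies with \<open>h\<close>.\<close>
  moreover have "\<alpha> (\<beta> h k) (inv\<^bsub>H\<^esub> h \<otimes>\<^bsub>H\<^esub> h') \<in> positive_cone H rH"
    using pos[of "\<beta> h k"] less h k H.left_order_iff_positive_cone[OF rH h] by auto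
  ultimately show ?thesis
    using H.left_order_iff_positive_cone[OF rH] h k by simp
qed

text \<open>The intersection matters because \<open><*lex*>\<close> ignores the second coordinates
  once the first ones are strictly related, and so also relates pairs with entries outside
  \<open>carrier K\<close>, which \<open>left_order\<close> forbids.\<close>

definition zs_lex :: "'a rel \<Rightarrow> 'b rel \<Rightarrow> ('a \<times> 'b) rel"
  where "zs_lex rH rK =
    (rH <*lex*> rK) \<inter> (carrier H \<times> carrier K) \<times> (carrier H \<times> carrier K)"

lemma strict_linear_order_zs_lex:
  assumes "left_order H rH" "left_order K rK"
  shows "strict_linear_order_on (carrier H \<times> carrier K) (zs_lex rH rK)"
proof -
  have "trans rH" "irrefl rH" "total_on (carrier H) rH"
    and "trans rK" "irrefl rK" "total_on (carrier K) rK"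
    using assms by (auto simp: left_order_def strict_linear_order_on_def)
  then have "trans (rH <*lex*> rK)" "irrefl (rH <*lex*> rK)"
    "total_on (carrier H \<times> carrier K) (rH <*lex*> rK)"
    by (simp_all add: irrefl_def total_on_lex_prod)
  \<comment> \<open>Transitivity and irreflexivity pass to any restriction of this kind, and
    totality is claimed only for pairs inside the carriers, where nothing is cut away.\<close>
  then show ?thesis
    unfolding strict_linear_order_on_def zs_lex_def
    by (simp add: trans_Restr irrefl_def total_on_def)
qed

lemma left_order_zs_lex:
  assumes rH: "left_order H rH" and rK: "left_order K rK"
    and pos: "\<And>k. k \<in> carrier K \<Longrightarrow> \<alpha> k ` positive_cone H rH \<subseteq> positive_cone H rH"
  shows "left_order (zappa_szep H K \<alpha> \<beta>) (zs_lex rH rK)"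
  unfolding left_order_def
proof (intro conjI ballI impI)
  show "zs_lex rH rK \<subseteq> carrier (zappa_szep H K \<alpha> \<beta>) \<times> carrier (zappa_szep H K \<alpha> \<beta>)"
    "strict_linear_order_on (carrier (zappa_szep H K \<alpha> \<beta>)) (zs_lex rH rK)"
    using strict_linear_order_zs_lex[OF rH rK] by (auto simp: zs_lex_def zappa_szep_def)
next
  fix x y z
  assume "x \<in> carrier (zappa_szep H K \<alpha> \<beta>)" and "(y, z) \<in> zs_lex rH rK"
  moreover obtain f g h k h' k' where eqs: "x = (f, g)" "y = (h, k)" "z = (h', k')"
    by (metis surj_pair)
  ultimately have carr: "f \<in> carrier H" "g \<in> carrier K" "h \<in> carrier H" "k \<in> carrier K"
      "h' \<in> carrier H" "k' \<in> carrier K"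
    and "(h, h') \<in> rH \<or> h = h' \<and> (k, k') \<in> rK"
    by (auto simp: zs_lex_def zappa_szep_def)
  \<comment> \<open>These are the two ways in which the products can compare lexicographically. In
    the second, \<open>h = h'\<close> makes the leading coordinates equal and the twists
    \<open>\<beta> h g\<close> and \<open>\<beta> h' g\<close> coincide.\<close>
  then have "(f \<otimes>\<^bsub>H\<^esub> \<alpha> g h, f \<otimes>\<^bsub>H\<^esub> \<alpha> g h') \<in> rH \<or>
      h = h' \<and> (\<beta> h g \<otimes>\<^bsub>K\<^esub> k, \<beta> h' g \<otimes>\<^bsub>K\<^esub> k') \<in> rK"
    using left_order_mult[OF rH alpha_mono[OF rH pos, of g h h'], of f]
      left_order_mult[OF rK, of k k' "\<beta> h g"] by blast
  then show "(x \<otimes>\<^bsub>zappa_szep H K \<alpha> \<beta>\<^esub> y, x \<otimes>\<^bsub>zappa_szep H K \<alpha> \<beta>\<^esub> z) \<in> zs_lex rH rK"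
    using carr by (auto simp: eqs zs_lex_def zappa_szep_def)
qed

text \<open>The copy of \<open>K\<close> is the fibre of the leading coordinate over the identity,
  and the leading coordinate is weakly monotone, so an element squeezed between two points of the
  fibre lies in it.\<close>

lemma convex_subgroup_zs_lex:
  assumes "left_order H rH"
  shows "convex_subgroup (zappa_szep H K \<alpha> \<beta>) (zs_lex rH rK) ({\<one>\<^bsub>H\<^esub>} \<times> carrier K)"
proof -
  interpret embed: group_hom K "zappa_szep H K \<alpha> \<beta>" "\<lambda>k. (\<one>\<^bsub>H\<^esub>, k)"
    by (intro group_hom.intro group_hom_axioms.intro K.is_group group_zappa_szep hom_embed_right)
  have "(\<lambda>k. (\<one>\<^bsub>H\<^esub>, k)) ` carrier K = {\<one>\<^bsub>H\<^esub>} \<times> carrier K"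
    by auto
  then have "subgroup ({\<one>\<^bsub>H\<^esub>} \<times> carrier K) (zappa_szep H K \<alpha> \<beta>)"
    using embed.img_is_subgroup by simp
  moreover have "y \<in> {\<one>\<^bsub>H\<^esub>} \<times> carrier K"
    if "x \<in> {\<one>\<^bsub>H\<^esub>} \<times> carrier K" "z \<in> {\<one>\<^bsub>H\<^esub>} \<times> carrier K"
      "(x, y) \<in> zs_lex rH rK" "(y, z) \<in> zs_lex rH rK" for x y z
  proof -
    have "trans rH" "irrefl rH"
      using assms by (auto simp: left_order_def strict_linear_order_on_def)
    \<comment> \<open>If either comparison is decided by the second coordinates,
      \<open>fst y\<close> is already the identity; only the case of two strict leading comparisons
      has to be excluded.\<close>
    then have "\<not> ((\<one>\<^bsub>H\<^esub>, fst y) \<in> rH \<and> (fst y, \<one>\<^bsub>H\<^esub>) \<in> rH)"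
      by (metis irreflD transD)
    then show ?thesis
      using that by (cases y) (auto simp: zs_lex_def)
  qed
  ultimately show ?thesis
    unfolding convex_subgroup_def by blast
qed

lemma positive_cone_zs_lex:
  assumes "left_order H rH"
  shows "positive_cone (zappa_szep H K \<alpha> \<beta>) (zs_lex rH rK) \<inter> ({\<one>\<^bsub>H\<^esub>} \<times> carrier K) =
    {\<one>\<^bsub>H\<^esub>} \<times> positive_cone K rK"
proof -
  \<comment> \<open>Hence two elements of the copy of \<open>K\<close> are never separated by their
    leading coordinates, and their comparison is left to \<open>rK\<close>.\<close>
  have "(\<one>\<^bsub>H\<^esub>, \<one>\<^bsub>H\<^esub>) \<notin> rH"
    using assms by (auto simp: left_order_def strict_linear_order_on_def irrefl_def)
  then show ?thesis
    by (auto simp: positive_cone_def zs_lex_def zappa_szep_def)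
qed

end

theorem theorem1:
  fixes H :: "('a, 'm) monoid_scheme"
    and K :: "('b, 'n) monoid_scheme"
    and G :: "('a \<times> 'b) monoid"
    and \<alpha> :: "'b \<Rightarrow> 'a \<Rightarrow> 'a"
    and \<beta> :: "'a \<Rightarrow> 'b \<Rightarrow> 'b"
    and rH :: "'a rel"
    and rK :: "'b rel"
    and PH :: "'a set"
    and PK :: "'b set"
  assumes "zappa_szep_pair H K \<alpha> \<beta>" and "G = zappa_szep H K \<alpha> \<beta>"
    and "left_order H rH" and "PH = positive_cone H rH"
    and "left_order K rK" and "PK = positive_cone K rK"
    and "\<And>k. k \<in> carrier K \<Longrightarrow> \<alpha> k ` PH \<subseteq> PH"
  shows "\<exists>r P. left_order G r \<and> P = positive_cone G r \<and>
      convex_subgroup G r ({\<one>\<^bsub>H\<^esub>} \<times> carrier K) \<and>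
      {\<one>\<^bsub>H\<^esub>} \<times> PK = P \<inter> ({\<one>\<^bsub>H\<^esub>} \<times> carrier K)"
proof -
  interpret zappa_szep_pair H K \<alpha> \<beta>
    by fact
  have "left_order G (zs_lex rH rK)"
    using left_order_zs_lex[OF assms(3,5)] assms(2,4,7) by simp
  moreover have "convex_subgroup G (zs_lex rH rK) ({\<one>\<^bsub>H\<^esub>} \<times> carrier K)"
    using convex_subgroup_zs_lex[OF assms(3)] assms(2) by simp
  moreover have "{\<one>\<^bsub>H\<^esub>} \<times> PK = positive_cone G (zs_lex rH rK) \<inter> ({\<one>\<^bsub>H\<^esub>} \<times> carrier K)"
    using positive_cone_zs_lex[OF assms(3)] assms(2,6) by simp
  ultimately show ?thesis
    by blast
qed

end
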